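(* Consider $U_t+AU_x=SU$ with constant matrices $A,S\in\mathbb R^{m\times m}$, a linear reconstruction, and a linear numerical flux. Let $\mathcal L_h$ be the corresponding finite-volume residual and, for a vector $U_h$ of cell averages, let $V_h=\mathcal L_h(U_h)$. If the face flux-time derivatives and source-time derivatives are defined by $\widehat F_t=\widehat F(V_L,V_R)$ and $S_t=SV$ (that is, by applying the same reconstruction, numerical flux and source to $V_h$), then the conservatively assembled operator $\widetilde{\mathcal G}_h$ satisfies exactly $$\widetilde{\mathcal G}_h(U_h)=\mathcal G_h^{\rm tr}(U_h)=\mathcal L_h(V_h)=\mathcal L_h^2(U_h),\qquad \mathcal G_h^{\rm tr}(U_h):=D\mathcal L_h(U_h)\,\mathcal L_h(U_h).$$
   Context: Cells $I_i=[x_{i-1/2},x_{i+1/2}]$ have length $\Delta x_i$; $U_h=(\bar U_i)_i$ is the vector of cell averages, $\bar U_i\in\mathbb R^m$. A linear reconstruction assigns to $U_h$, by linear maps, a left and a right state $U_{L,i+1/2},U_{R,i+1/2}\in\mathbb R^m$ at every face. A linear numerical flux is a linear map $(U_L,U_R)\mapsto\widehat F(U_L,U_R)\in\mathbb R^m$. The residual is $$\mathcal L_{h,i}(U_h)=-\frac{\widehat F_{i+1/2}-\widehat F_{i-1/2}}{\Delta x_i}+S\bar U_i,\qquad \widehat F_{i+1/2}=\widehat F(U_{L,i+1/2},U_{R,i+1/2}),$$ with the same face value used by both adjacent cells. With $V_h=\mathcal L_h(U_h)=(\bar V_i)_i$ and $V_{L},V_{R}$ its reconstructed face states, the derivative operator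 is assembled as $$\widetilde{\mathcal G}_{h,i}(U_h)=-\frac{\widehat F_{t,i+1/2}-\widehat F_{t,i-1/2}}{\Delta x_i}+S\bar V_i,\qquad \widehat F_{t,i+1/2}=\widehat F(V_{L,i+1/2},V_{R,i+1/2}).$$ *)

theory Defs
  imports "HOL-Analysis.Analysis"
begin

(* The N = CARD('n) cells are indexed by the linearly ordered finite type 'n, read from left to
   right; the N + 1 faces are numbered 0, ..., N, and the cell at position p lies between the
   faces p and p + 1.  Interior faces are thereby shared by the two adjacent cells.  Boundary
   treatment is part of the reconstruction; periodicity, for instance, means that the
   reconstructions at the faces 0 and N coincide.

   The fields advection and source are the matrices A and S of U_t + A U_x = S U.  The matrix A
   does not enter the discrete operators directly: it is only represented through num_flux, on
   which nothing but linearity (in particular no consistency with A) is required. *)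
record ('m, 'n) fv_scheme =
  advection :: "real ^ 'm::finite ^ 'm"
  source    :: "real ^ 'm ^ 'm"
  node      :: "nat \<Rightarrow> real"
  recon_L   :: "nat \<Rightarrow> real ^ 'm ^ 'n::finite \<Rightarrow> real ^ 'm"
  recon_R   :: "nat \<Rightarrow> real ^ 'm ^ 'n \<Rightarrow> real ^ 'm"
  num_flux  :: "real ^ 'm \<Rightarrow> real ^ 'm \<Rightarrow> real ^ 'm"

definition left_face :: "'n::{finite, linorder} \<Rightarrow> nat" where
  "left_face i = card {j. j < i}"

definition right_face :: "'n::{finite, linorder} \<Rightarrow> nat" where
  "right_face i = left_face i + 1"

definition mesh_size :: "('m::finite, 'n::{finite, linorder}) fv_scheme \<Rightarrow> 'n \<Rightarrow> real" where
  "mesh_size sch i = node sch (right_face i) - node sch (left_face i)"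

definition linear_fv_scheme :: "('m::finite, 'n::{finite, linorder}) fv_scheme \<Rightarrow> bool" where
  "linear_fv_scheme sch \<longleftrightarrow>
     strict_mono_on {..CARD('n)} (node sch) \<and>
     (\<forall>k\<le>CARD('n). linear (recon_L sch k) \<and> linear (recon_R sch k)) \<and>
     linear (\<lambda>(UL, UR). num_flux sch UL UR)"

definition conservative_assembly ::
  "('m::finite, 'n::{finite, linorder}) fv_scheme
     \<Rightarrow> (nat \<Rightarrow> real ^ 'm) \<Rightarrow> ('n \<Rightarrow> real ^ 'm) \<Rightarrow> real ^ 'm ^ 'n::{finite, linorder}" where
  "conservative_assembly sch F s =
     (\<chi> i. - ((F (right_face i) - F (left_face i)) /\<^sub>R mesh_size sch i) + s i)"

definition face_flux ::
  "('m::finite, 'n::{finite, linorder}) fv_scheme \<Rightarrow> real ^ 'm ^ 'n::{finite, linorder} \<Rightarrow> nat \<Rightarrow> real ^ 'm" where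
  "face_flux sch U k = num_flux sch (recon_L sch k U) (recon_R sch k U)"

definition residual ::
  "('m::finite, 'n::{finite, linorder}) fv_scheme \<Rightarrow> real ^ 'm ^ 'n::{finite, linorder} \<Rightarrow> real ^ 'm ^ 'n::{finite, linorder}" where
  "residual sch U = conservative_assembly sch (face_flux sch U) (\<lambda>i. source sch *v (U $ i))"

definition face_flux_t ::
  "('m::finite, 'n::{finite, linorder}) fv_scheme \<Rightarrow> real ^ 'm ^ 'n::{finite, linorder} \<Rightarrow> nat \<Rightarrow> real ^ 'm" where
  "face_flux_t sch U k =
     (let V = residual sch U in num_flux sch (recon_L sch k V) (recon_R sch k V))"

definition source_t ::
  "('m::finite, 'n::{finite, linorder}) fv_scheme \<Rightarrow> real ^ 'm ^ 'n::{finite, linorder} \<Rightarrow> 'n \<Rightarrow> real ^ 'm" where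
  "source_t sch U i = (let V = residual sch U in source sch *v (V $ i))"

definition assembled_derivative ::
  "('m::finite, 'n::{finite, linorder}) fv_scheme \<Rightarrow> real ^ 'm ^ 'n::{finite, linorder} \<Rightarrow> real ^ 'm ^ 'n::{finite, linorder}" where
  "assembled_derivative sch U =
     conservative_assembly sch (face_flux_t sch U) (source_t sch U)"

definition true_derivative ::
  "('m::finite, 'n::{finite, linorder}) fv_scheme \<Rightarrow> real ^ 'm ^ 'n::{finite, linorder} \<Rightarrow> real ^ 'm ^ 'n::{finite, linorder}" where
  "true_derivative sch U = frechet_derivative (residual sch) (at U) (residual sch U)"

end

theory Submission
  imports Defs
begin

text \<open>Two facts meet. The assembled operator is, by its construction, the residual formula
  evaluated at \<open>residual sch U\<close> (\<open>assembled_derivative_eq_residual\<close>). Each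
  face flux is a linear map composed with linear reconstructions (\<open>linear_face_flux\<close>),
  so the residual is linear (\<open>linear_residual\<close>) and its derivative, applied to
  \<open>residual sch U\<close>, is the residual applied twice.\<close>

text \<open>The residual is itself a linear map of the cell averages, hence equal to its own Frechet
  derivative at every point.\<close>

lemma left_face_less_card: "left_face (i :: 'n::{finite, linorder}) < CARD('n)"
  unfolding left_face_def by (rule psubset_card_mono) auto

lemma linear_face_flux:
  fixes sch :: "('m::finite, 'n::{finite, linorder}) fv_scheme"
  assumes "linear_fv_scheme sch" and "k \<le> CARD('n)"
  shows "linear (\<lambda>U. face_flux sch U k)"
proof -
  have L: "linear (recon_L sch k)" and R: "linear (recon_R sch k)"
    and F: "linear (\<lambda>(UL, UR). num_flux sch UL UR)"
    using assms by (auto simp: linear_fv_scheme_def)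
  \<comment> \<open>The flux is jointly linear in the pair of states, not bilinear, so it composes
    with the paired reconstructions.\<close>
  have "linear (\<lambda>U. (recon_L sch k U, recon_R sch k U))"
    by (rule linearI) (simp_all add: linear_add[OF L] linear_add[OF R] linear_scale[OF L] linear_scale[OF R])
  from linear_compose[OF this F] show ?thesis
    by (simp add: o_def face_flux_def)
qed

lemma linear_residual:
  fixes sch :: "('m::finite, 'n::{finite, linorder}) fv_scheme"
  assumes "linear_fv_scheme sch"
  shows "linear (residual sch)"
proof -
  have l: "linear (\<lambda>U. face_flux sch U (left_face i))"
    and r: "linear (\<lambda>U. face_flux sch U (right_face i))" for i :: 'n
    using linear_face_flux[OF assms] left_face_less_card[of i] by (simp_all add: right_face_def)
  show ?thesis
    by (rule linearI)
      (simp_all add: vec_eq_iff residual_def conservative_assembly_def linear_add[OF l] linear_add[OF r]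
        linear_scale[OF l] linear_scale[OF r] matrix_vector_right_distrib
        matrix_vector_mult_scaleR algebra_simps)
qed

lemma assembled_derivative_eq_residual:
  "assembled_derivative sch U = residual sch (residual sch U)"
  \<comment> \<open>Only the outer residual is unfolded; the inner one stays whole and serves as
    \<open>V\<close>.\<close>
  by (simp add: assembled_derivative_def residual_def[of sch "residual sch U"]
      conservative_assembly_def face_flux_t_def source_t_def face_flux_def Let_def)

theorem proposition3:
  fixes sch :: "('m::finite, 'n::{finite, linorder}) fv_scheme"
    and U V :: "real ^ 'm ^ 'n::{finite, linorder}"
  assumes "linear_fv_scheme sch"
    and "V = residual sch U"
  shows "residual sch differentiable (at U) \<and>
         assembled_derivative sch U = true_derivative sch U \<and>
         true_derivative sch U = residual sch V \<and>
         residual sch V = (residual sch ^^ 2) U"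
proof -
  have D: "(residual sch has_derivative residual sch) (at U)"
    by (rule linear_imp_has_derivative[OF linear_residual[OF assms(1)]])
  have "true_derivative sch U = residual sch V"
    \<comment> \<open>Uniqueness of the Frechet derivative replaces it by
      \<open>residual sch\<close>.\<close>
    unfolding true_derivative_def frechet_derivative_at[OF D, symmetric] assms(2) ..
  then show ?thesis
    using D by (auto simp: differentiable_def assembled_derivative_eq_residual assms(2) numeral_2_eq_2)
qed

end
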